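(* There exists a positive semidefinite polynomial $f\in\mathbb{R}[x,y,z]$ that has a bad point at the origin, but that is a sum of squares in the ring of formal power series $\mathbb{R}[[x,y,z]]$.
   Context: A polynomial $f\in\mathbb{R}[x_1,\dots,x_n]$ is positive semidefinite if $f(a)\geq 0$ for all $a\in\mathbb{R}^n$. A bad point of such an $f$ is a point $p\in\mathbb{C}^n$ such that, in every representation $f=\sum_i f_i^2$ of $f$ as a finite sum of squares of rational functions $f_i\in\mathbb{R}(x_1,\dots,x_n)$, the (reduced) denominator of some $f_i$ vanishes at $p$. Equivalently, $f$ is not a finite sum of squares in the local ring $\mathbb{R}[x_1,\dots,x_n]_{\mathfrak{m}_p}$, where $\mathfrak{m}_p\subset\mathbb{R}[x_1,\dots,x_n]$ is the maximal ideal of real polynomials vanishing at $p$. *)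

theory Defs
  imports Complex_Main "HOL-Computational_Algebra.Computational_Algebra" "HOL-Computational_Algebra.Field_as_Ring"
begin

text \<open>
  Multivariate rings are iterated univariate ones:
  \<open>\<real>[x,y,z]\<close> is \<open>\<real>[x][y][z]\<close> and \<open>\<real>[[x,y,z]]\<close> is \<open>\<real>[[x]][[y]][[z]]\<close>. The innermost
  variable is \<open>x\<close>, the outermost is \<open>z\<close>; the coefficient of \<open>x\<^sup>i y\<^sup>j z\<^sup>k\<close> in \<open>f\<close> is
  \<open>coeff (coeff (coeff f k) j) i\<close>.
\<close>

type_synonym 'a poly3 = "'a poly poly poly"
type_synonym ratfun3 = "real poly3 fract"
type_synonym 'a fps3 = "'a fps fps fps"

definition eval3 :: "'a::comm_semiring_1 poly3 \<Rightarrow> 'a \<times> 'a \<times> 'a \<Rightarrow> 'a" where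
  "eval3 f = (\<lambda>(x, y, z). poly (poly (poly f [:[:z:]:]) [:y:]) x)"

definition complexify :: "real poly3 \<Rightarrow> complex poly3" where
  "complexify f = map_poly (map_poly (map_poly complex_of_real)) f"

definition psd :: "real poly3 \<Rightarrow> bool" where
  "psd f \<longleftrightarrow> (\<forall>a. eval3 f a \<ge> 0)"

text \<open>
  \<open>quot_of_fract r\<close> is the coprime representation of \<open>r\<close>, made unique by normalizing the
  denominator up to a unit, so its second component is the reduced denominator.
\<close>

definition reduced_denom :: "ratfun3 \<Rightarrow> real poly3" where
  "reduced_denom r = snd (quot_of_fract r)"

definition bad_point :: "real poly3 \<Rightarrow> complex \<times> complex \<times> complex \<Rightarrow> bool" where
  "bad_point f p \<longleftrightarrow>
     (\<forall>rs :: ratfun3 list. to_fract f = (\<Sum>r\<leftarrow>rs. r ^ 2) \<longrightarrow>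
        (\<exists>r\<in>set rs. eval3 (complexify (reduced_denom r)) p = 0))"

definition sum_of_squares :: "'a::comm_semiring_1 \<Rightarrow> bool" where
  "sum_of_squares f \<longleftrightarrow> (\<exists>gs. f = (\<Sum>g\<leftarrow>gs. g ^ 2))"

definition fps3_of_poly3 :: "'a::comm_ring_1 poly3 \<Rightarrow> 'a fps3" where
  "fps3_of_poly3 f =
     fps_of_poly (map_poly (\<lambda>g. fps_of_poly (map_poly fps_of_poly g)) f)"

lemma fps3_of_poly3_nth:
  "fps_nth (fps_nth (fps_nth (fps3_of_poly3 f) k) j) i = coeff (coeff (coeff f k) j) i"
  by (simp add: fps3_of_poly3_def coeff_map_poly)

lemma eval3_monom:
  "eval3 (monom (monom (monom c i) j) k) (x, y, z) = c * x ^ i * y ^ j * z ^ k"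
  by (simp add: eval3_def poly_monom poly_const_pow ac_simps)

lemma eval3_add: "eval3 (f + g) a = eval3 f a + eval3 g a"
  by (simp add: eval3_def split: prod.split)

lemma coeff_complexify:
  "coeff (coeff (coeff (complexify f) k) j) i = complex_of_real (coeff (coeff (coeff f k) j) i)"
  by (simp add: complexify_def coeff_map_poly)

lemma reduced_denom_nonzero: "reduced_denom r \<noteq> 0"
  and coprime_reduced_denom: "coprime (fst (quot_of_fract r)) (reduced_denom r)"
  and Fract_reduced_denom: "Fract (fst (quot_of_fract r)) (reduced_denom r) = r"
  using quot_to_fract_quot_of_fract[of r]
  by (simp_all add: reduced_denom_def coprime_quot_of_fract quot_to_fract_def case_prod_unfold)

end

theory Submission
  imports Defs
begin

text \<open>
  Let \<open>P = x\<^sup>2 - x\<^sup>3 + z\<^sup>2\<close>, \<open>B = y\<^sup>2 - x z\<close> and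
  \<open>f = P (P + B) + x\<^sup>2 B\<^sup>2\<close>. The idea is that the squares in a representation of \<open>f\<close> are
  forced to vanish along a curve through the origin by real points that lie far away from the
  origin, and power series at the origin do not see this constraint.

  Both \<open>P = x\<^sup>2 (1 - x) + z\<^sup>2\<close> and
  \<open>P + B = y\<^sup>2 + (z - x/2)\<^sup>2 + x\<^sup>2 (3/4 - x)\<close> are nonnegative for \<open>x \<le> 3/4\<close>, while
  \<open>f = (P + B/2)\<^sup>2 + (x\<^sup>2 - 1/4) B\<^sup>2\<close> settles \<open>x \<ge> 3/4\<close>. So \<open>f\<close> is positive semidefinite.

  The constants \<open>1\<close> and \<open>3/4\<close> being positive, \<open>1 - x\<close> and \<open>3/4 - x\<close> have
  square roots in \<open>\<real>[[x]]\<close>. Hence \<open>P\<close> and \<open>P + B\<close> are sums of squares of power series,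
  and so is \<open>f\<close>.

  The set \<open>P = B = 0\<close> contains the curve \<open>t \<mapsto> (1 + t\<^sup>4) (1, t, t\<^sup>2)\<close>, whose
  points with \<open>t\<close> real have \<open>x \<ge> 1\<close>. It passes through the origin only for the four nonreal
  roots of \<open>1 + t\<^sup>4\<close>. If \<open>h\<^sup>2 f = \<Sum> g\<^sub>i\<^sup>2\<close> for polynomials, then the \<open>g\<^sub>i\<close> vanish at these real
  points of the curve, hence identically along it. Along the four complex
  branches at the origin this forces \<open>g\<^sub>i\<close> to have no term of degree below \<open>2\<close> and a quadratic
  part of the form \<open>\<sigma>\<^sub>i (x\<^sup>2 + z\<^sup>2) + \<tau>\<^sub>i (y\<^sup>2 - x z)\<close> (\<open>jet_of_vanishing_on_curve\<close>).
  Write \<open>p = x\<^sup>2 + z\<^sup>2\<close> and \<open>b = y\<^sup>2 - x z\<close>. In degree \<open>4\<close> one finds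
  \<open>h(0)\<^sup>2 (p\<^sup>2 + p b) = \<Sum> (\<sigma>\<^sub>i p + \<tau>\<^sub>i b)\<^sup>2\<close>. The absence of \<open>b\<^sup>2\<close> on the left gives \<open>\<tau>\<^sub>i = 0\<close>, so
  that \<open>p b\<close> does not occur on the right and \<open>h(0) = 0\<close>
  (\<open>bad_poly_multiplier_vanishes_at_origin\<close>). A representation of \<open>f\<close> by rational functions
  with denominators not vanishing at the origin would provide such an \<open>h\<close> with \<open>h(0) \<noteq> 0\<close>
  (\<open>common_denominator\<close>).
\<close>


section \<open>Evaluation and sums of squares\<close>

lemma eval3_mult: "eval3 (f * g) a = eval3 f a * eval3 g a"
  by (simp add: eval3_def split: prod.split)

lemma eval3_power: "eval3 (f ^ n) a = eval3 f a ^ n"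
  by (simp add: eval3_def split: prod.split)

lemma eval3_sum_list_squares:
  "eval3 (\<Sum>g\<leftarrow>gs. g ^ 2) a = (\<Sum>g\<leftarrow>gs. eval3 g a ^ 2)"
proof (induction gs)
  case Nil
  show ?case by (simp add: eval3_def split: prod.split)
next
  case (Cons g gs)
  then show ?case by (simp only: list.map sum_list.Cons eval3_add eval3_power)
qed

lemma eval3_complexify_origin:
  "eval3 (complexify d) (0, 0, 0) = complex_of_real (eval3 d (0, 0, 0))"
  by (simp add: eval3_def poly_0_coeff_0 coeff_complexify)

lemma fps3_of_poly3_add: "fps3_of_poly3 (f + g) = fps3_of_poly3 f + fps3_of_poly3 g"
  by (simp add: fps_eq_iff fps3_of_poly3_nth)

lemma fps3_of_poly3_mult: "fps3_of_poly3 (f * g) = fps3_of_poly3 f * fps3_of_poly3 g"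
  by (simp add: fps_eq_iff fps3_of_poly3_nth coeff_mult coeff_sum fps_mult_nth fps_sum_nth atLeast0AtMost)

lemma sum_of_squares_square: "sum_of_squares (g ^ 2)"
  unfolding sum_of_squares_def by (rule exI[of _ "[g]"]) simp

lemma sum_of_squares_add:
  assumes "sum_of_squares a" "sum_of_squares b"
  shows "sum_of_squares (a + b)"
proof -
  from assms obtain gs hs where "a = (\<Sum>g\<leftarrow>gs. g ^ 2)" "b = (\<Sum>g\<leftarrow>hs. g ^ 2)"
    unfolding sum_of_squares_def by blast
  then have "a + b = (\<Sum>g\<leftarrow>gs @ hs. g ^ 2)" by simp
  then show ?thesis unfolding sum_of_squares_def by blast
qed

lemma sum_of_squares_square_mult:
  assumes "sum_of_squares a"
  shows "sum_of_squares (c ^ 2 * a)"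
proof -
  from assms obtain gs where gs: "a = (\<Sum>g\<leftarrow>gs. g ^ 2)"
    unfolding sum_of_squares_def by blast
  have "c ^ 2 * a = (\<Sum>g\<leftarrow>map ((*) c) gs. g ^ 2)"
    unfolding gs by (simp add: sum_list_const_mult[symmetric] power_mult_distrib o_def)
  then show ?thesis unfolding sum_of_squares_def by blast
qed

lemma sum_of_squares_mult:
  assumes "sum_of_squares a" "sum_of_squares b"
  shows "sum_of_squares (a * b)"
proof -
  from assms(1) obtain gs where "a = (\<Sum>g\<leftarrow>gs. g ^ 2)"
    unfolding sum_of_squares_def by blast
  moreover have "sum_of_squares ((\<Sum>g\<leftarrow>gs. g ^ 2) * b)"
  proof (induction gs)
    case Nil
    show ?case unfolding sum_of_squares_def by (rule exI[of _ "[]"]) simp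
  next
    case (Cons g gs)
    then show ?case
      using sum_of_squares_add[OF sum_of_squares_square_mult[OF assms(2), of g] Cons]
      by (simp add: distrib_right)
  qed
  ultimately show ?thesis by simp
qed


section \<open>The polynomial\<close>

definition X3 :: "'a::comm_ring_1 poly3" where "X3 = [:[:[:0, 1:]:]:]"
definition Y3 :: "'a::comm_ring_1 poly3" where "Y3 = [:[:0, 1:]:]"
definition Z3 :: "'a::comm_ring_1 poly3" where "Z3 = [:0, 1:]"

text \<open>
  In the \<open>x z\<close>-plane this is a rational cubic with an isolated real point at the origin, where the
  tangents \<open>z = \<plusminus>i x\<close> are not real. Its other real points have \<open>x \<ge> 1\<close>.
\<close>

definition acnodal_cubic :: "real poly3" where
  "acnodal_cubic = X3 ^ 2 - X3 ^ 3 + Z3 ^ 2"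

text \<open>
  The cone swept out by the directions \<open>(1, t, t\<^sup>2)\<close>: on it \<open>z = t\<^sup>2 x\<close>, and away
  from the vertex the cubic above becomes \<open>x = 1 + t\<^sup>4\<close>, a quartic without real roots.
\<close>

definition conic_cone :: "real poly3" where
  "conic_cone = Y3 ^ 2 - X3 * Z3"

text \<open>
  As a quadratic form in the cubic and the cone, with coefficients in \<open>\<real>[x]\<close>, this has Gram
  determinant \<open>x\<^sup>2 - 1/4\<close>: it is positive definite along the real curve, where \<open>x \<ge> 1\<close>, but
  indefinite at the origin. This change of signature makes the origin a bad point.
\<close>

definition bad_poly :: "real poly3" where
  "bad_poly = acnodal_cubic * (acnodal_cubic + conic_cone) + (X3 * conic_cone) ^ 2"

lemma eval3_acnodal_cubic: "eval3 acnodal_cubic (x, y, z) = x ^ 2 - x ^ 3 + z ^ 2"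
  by (simp add: acnodal_cubic_def X3_def Z3_def eval3_def)

lemma eval3_conic_cone: "eval3 conic_cone (x, y, z) = y ^ 2 - x * z"
  by (simp add: conic_cone_def X3_def Y3_def Z3_def eval3_def)

lemma eval3_bad_poly:
  "eval3 bad_poly (x, y, z) =
     (x ^ 2 - x ^ 3 + z ^ 2) * (x ^ 2 - x ^ 3 + z ^ 2 + (y ^ 2 - x * z)) + (x * (y ^ 2 - x * z)) ^ 2"
proof -
  have "eval3 X3 (x, y, z) = x" by (simp add: X3_def eval3_def)
  then show ?thesis
    by (simp add: bad_poly_def eval3_add eval3_mult eval3_power eval3_acnodal_cubic eval3_conic_cone)
qed

lemma psd_bad_poly: "psd bad_poly"
  unfolding psd_def
proof
  fix a :: "real \<times> real \<times> real"
  obtain x y z where a: "a = (x, y, z)" by (cases a) auto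
  define p where "p = x ^ 2 - x ^ 3 + z ^ 2"
  define b where "b = y ^ 2 - x * z"
  have "p * (p + b) + (x * b) ^ 2 \<ge> 0"
  \<comment> \<open>Any threshold between 1/2 (definiteness of the form in p and b) and 3/4 would do.\<close>
  proof (cases "x \<le> 3 / 4")
    case True
    have "p = x ^ 2 * (1 - x) + z ^ 2"
      by (simp add: p_def algebra_simps power2_eq_square power3_eq_cube)
    then have "p \<ge> 0" using True by simp
    moreover have "p + b = x ^ 2 * (3 / 4 - x) + (z - x / 2) ^ 2 + y ^ 2"
      by (simp add: p_def b_def algebra_simps power2_eq_square power3_eq_cube)
    then have "p + b \<ge> 0" using True by simp
    ultimately show ?thesis by simp
  next
    case False
    have "p * (p + b) + (x * b) ^ 2 = (p + b / 2) ^ 2 + (x ^ 2 - 1 / 4) * b ^ 2"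
      by (simp add: algebra_simps power2_eq_square)
    moreover have "x ^ 2 \<ge> (3 / 4) ^ 2"
      using False by (intro power_mono) auto
    then have "x ^ 2 - 1 / 4 \<ge> 0" by (simp add: power2_eq_square)
    ultimately show ?thesis by simp
  qed
  then show "eval3 bad_poly a \<ge> 0"
    unfolding a eval3_bad_poly p_def b_def .
qed


section \<open>A formal sum of squares\<close>

lemma fps_sqrt_exists:
  fixes a :: "real fps"
  assumes "fps_nth a 0 > 0"
  shows "\<exists>r. a = r ^ 2"
proof -
  have "(root (Suc 1) (fps_nth a 0)) ^ Suc 1 = fps_nth a 0"
    using assms by (intro real_root_pow_pos2) auto
  then have "(fps_radical root (Suc 1) a) ^ Suc 1 = a"
    using power_radical[of a root 1] assms by simp
  then show ?thesis by (metis Suc_1)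
qed

lemma sum_of_squares_fps3_of_square: "sum_of_squares (fps3_of_poly3 (g ^ 2))"
  using sum_of_squares_square[of "fps3_of_poly3 g"]
  by (simp add: power2_eq_square fps3_of_poly3_mult)

text \<open>
  \<open>c - x\<close> takes negative values, so it is not a sum of squares of polynomials; but it is positive
  at the origin and thus the square of a power series in \<open>x\<close> alone.
\<close>

lemma sum_of_squares_fps3_square_mult_linear:
  assumes "(c::real) > 0"
  shows "sum_of_squares (fps3_of_poly3 (g ^ 2 * [:[:[:c, -1:]:]:]))"
proof -
  have *: "map_poly h [:a:] = [:h a:]" if "h 0 = 0" for h :: "'u::zero \<Rightarrow> 'v::zero" and a
    using that by (intro poly_eqI) (simp add: coeff_map_poly coeff_pCons split: nat.split)
  obtain r where r: "fps_of_poly [:c, -1:] = r ^ 2"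
    using fps_sqrt_exists[of "fps_of_poly [:c, -1:]"] assms by auto
  have "fps3_of_poly3 [:[:[:c, -1:]:]:] = fps_const (fps_const (fps_of_poly [:c, -1:]))"
    unfolding fps3_of_poly3_def by (simp add: *)
  also have "\<dots> = (fps_const (fps_const r)) ^ 2"
    unfolding r by (simp add: fps_const_power)
  finally have "fps3_of_poly3 (g ^ 2 * [:[:[:c, -1:]:]:])
      = (fps3_of_poly3 g * fps_const (fps_const r)) ^ 2"
    unfolding power_mult_distrib fps3_of_poly3_mult power2_eq_square[of g]
    by (simp only: power2_eq_square)
  then show ?thesis by (simp only: sum_of_squares_square)
qed

lemma sum_of_squares_fps3_bad_poly: "sum_of_squares (fps3_of_poly3 bad_poly)"
proof -
  have eqP: "acnodal_cubic = Z3 ^ 2 + X3 ^ 2 * [:[:[:1, -1:]:]:]"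
    by (simp add: acnodal_cubic_def X3_def Z3_def power2_eq_square power3_eq_cube)
  have P: "sum_of_squares (fps3_of_poly3 acnodal_cubic)"
    unfolding eqP fps3_of_poly3_add
    by (intro sum_of_squares_add sum_of_squares_fps3_of_square sum_of_squares_fps3_square_mult_linear) simp_all
  have eqQ: "acnodal_cubic + conic_cone
      = (Y3 ^ 2 + (Z3 - [:[:[:1/2:]:]:] * X3) ^ 2) + X3 ^ 2 * [:[:[:3/4, -1:]:]:]"
    by (simp add: acnodal_cubic_def conic_cone_def X3_def Y3_def Z3_def
        power2_eq_square power3_eq_cube)
  have Q: "sum_of_squares (fps3_of_poly3 (acnodal_cubic + conic_cone))"
    unfolding eqQ fps3_of_poly3_add
    by (intro sum_of_squares_add sum_of_squares_fps3_of_square sum_of_squares_fps3_square_mult_linear) simp_all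
  show ?thesis
    unfolding bad_poly_def fps3_of_poly3_add[of "_ * _"] fps3_of_poly3_mult[of "acnodal_cubic"]
    by (intro sum_of_squares_add sum_of_squares_mult P Q sum_of_squares_fps3_of_square)
qed


section \<open>Second-order jets along polynomial arcs\<close>

text \<open>
  The coefficients describe the Taylor polynomial of \<open>F\<close> of degree \<open>2\<close> at the origin. It is tested
  on all arcs \<open>s \<cdot> (u, v, w)\<close> with polynomial entries, and the remainder must be divisible by
  \<open>s\<^sup>3\<close> as a polynomial in the parameter. A single expansion then serves two purposes: with
  \<open>s = 1 + t\<^sup>4\<close> it measures vanishing along the curve by divisibility, also at the nonreal roots of
  \<open>s\<close>, and with \<open>s = t\<close> and constant \<open>(u, v, w)\<close> it gives limits along rays.
\<close>

definition is_2jet :: "(real \<times> real \<times> real \<Rightarrow> real) \<Rightarrow>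
    real \<Rightarrow> real \<Rightarrow> real \<Rightarrow> real \<Rightarrow> real \<Rightarrow> real \<Rightarrow> real \<Rightarrow> real \<Rightarrow> real \<Rightarrow> real \<Rightarrow> bool" where
  "is_2jet F c l1 l2 l3 q11 q22 q33 q12 q13 q23 \<longleftrightarrow> (\<forall>s u v w :: real poly. \<exists>r. \<forall>t.
     F (poly (s * u) t, poly (s * v) t, poly (s * w) t) =
     poly ([:c:] + s * (smult l1 u + smult l2 v + smult l3 w)
       + s ^ 2 * (smult q11 (u ^ 2) + smult q22 (v ^ 2) + smult q33 (w ^ 2)
           + smult q12 (u * v) + smult q13 (u * w) + smult q23 (v * w))
       + s ^ 3 * r) t)"

lemma is_2jet_const: "is_2jet (\<lambda>_. c) c 0 0 0 0 0 0 0 0 0"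
  unfolding is_2jet_def by (intro allI exI[of _ 0]) simp

lemma is_2jet_add:
  assumes "is_2jet F c l1 l2 l3 q11 q22 q33 q12 q13 q23"
    and "is_2jet G c' l1' l2' l3' q11' q22' q33' q12' q13' q23'"
  shows "is_2jet (\<lambda>a. F a + G a) (c + c') (l1 + l1') (l2 + l2') (l3 + l3')
    (q11 + q11') (q22 + q22') (q33 + q33') (q12 + q12') (q13 + q13') (q23 + q23')"
  unfolding is_2jet_def
proof (intro allI)
  fix s u v w :: "real poly"
  obtain r where r: "\<forall>t. F (poly (s * u) t, poly (s * v) t, poly (s * w) t) =
     poly ([:c:] + s * (smult l1 u + smult l2 v + smult l3 w)
       + s ^ 2 * (smult q11 (u ^ 2) + smult q22 (v ^ 2) + smult q33 (w ^ 2)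
           + smult q12 (u * v) + smult q13 (u * w) + smult q23 (v * w)) + s ^ 3 * r) t"
    using assms(1) unfolding is_2jet_def by blast
  obtain r' where r': "\<forall>t. G (poly (s * u) t, poly (s * v) t, poly (s * w) t) =
     poly ([:c':] + s * (smult l1' u + smult l2' v + smult l3' w)
       + s ^ 2 * (smult q11' (u ^ 2) + smult q22' (v ^ 2) + smult q33' (w ^ 2)
           + smult q12' (u * v) + smult q13' (u * w) + smult q23' (v * w)) + s ^ 3 * r') t"
    using assms(2) unfolding is_2jet_def by blast
  show "\<exists>r. \<forall>t. F (poly (s * u) t, poly (s * v) t, poly (s * w) t)
       + G (poly (s * u) t, poly (s * v) t, poly (s * w) t) =
     poly ([:c + c':] + s * (smult (l1 + l1') u + smult (l2 + l2') v + smult (l3 + l3') w)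
       + s ^ 2 * (smult (q11 + q11') (u ^ 2) + smult (q22 + q22') (v ^ 2) + smult (q33 + q33') (w ^ 2)
           + smult (q12 + q12') (u * v) + smult (q13 + q13') (u * w) + smult (q23 + q23') (v * w))
       + s ^ 3 * r) t"
    by (intro exI[of _ "r + r'"] allI) (simp only: r r', simp add: algebra_simps)
qed

lemma is_2jet_mult_x:
  assumes "is_2jet F c l1 l2 l3 q11 q22 q33 q12 q13 q23"
  shows "is_2jet (\<lambda>(x, y, z). x * F (x, y, z)) 0 c 0 0 l1 0 0 l2 l3 0"
  unfolding is_2jet_def
proof (intro allI)
  fix s u v w :: "real poly"
  let ?Q = "smult q11 (u ^ 2) + smult q22 (v ^ 2) + smult q33 (w ^ 2)
           + smult q12 (u * v) + smult q13 (u * w) + smult q23 (v * w)"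
  obtain r where r: "\<forall>t. F (poly (s * u) t, poly (s * v) t, poly (s * w) t) =
     poly ([:c:] + s * (smult l1 u + smult l2 v + smult l3 w) + s ^ 2 * ?Q + s ^ 3 * r) t"
    using assms unfolding is_2jet_def by blast
  show "\<exists>r. \<forall>t. (case (poly (s * u) t, poly (s * v) t, poly (s * w) t) of (x, y, z) \<Rightarrow> x * F (x, y, z)) =
     poly ([:0:] + s * (smult c u + smult 0 v + smult 0 w)
       + s ^ 2 * (smult l1 (u ^ 2) + smult 0 (v ^ 2) + smult 0 (w ^ 2)
           + smult l2 (u * v) + smult l3 (u * w) + smult 0 (v * w)) + s ^ 3 * r) t"
    by (intro exI[of _ "u * ?Q + s * u * r"] allI)
       (simp only: prod.case r, simp add: algebra_simps power2_eq_square power3_eq_cube)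
qed

lemma is_2jet_mult_y:
  assumes "is_2jet F c l1 l2 l3 q11 q22 q33 q12 q13 q23"
  shows "is_2jet (\<lambda>(x, y, z). y * F (x, y, z)) 0 0 c 0 0 l2 0 l1 0 l3"
  unfolding is_2jet_def
proof (intro allI)
  fix s u v w :: "real poly"
  let ?Q = "smult q11 (u ^ 2) + smult q22 (v ^ 2) + smult q33 (w ^ 2)
           + smult q12 (u * v) + smult q13 (u * w) + smult q23 (v * w)"
  obtain r where r: "\<forall>t. F (poly (s * u) t, poly (s * v) t, poly (s * w) t) =
     poly ([:c:] + s * (smult l1 u + smult l2 v + smult l3 w) + s ^ 2 * ?Q + s ^ 3 * r) t"
    using assms unfolding is_2jet_def by blast
  show "\<exists>r. \<forall>t. (case (poly (s * u) t, poly (s * v) t, poly (s * w) t) of (x, y, z) \<Rightarrow> y * F (x, y, z)) =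
     poly ([:0:] + s * (smult 0 u + smult c v + smult 0 w)
       + s ^ 2 * (smult 0 (u ^ 2) + smult l2 (v ^ 2) + smult 0 (w ^ 2)
           + smult l1 (u * v) + smult 0 (u * w) + smult l3 (v * w)) + s ^ 3 * r) t"
    by (intro exI[of _ "v * ?Q + s * v * r"] allI)
       (simp only: prod.case r, simp add: algebra_simps power2_eq_square power3_eq_cube)
qed

lemma is_2jet_mult_z:
  assumes "is_2jet F c l1 l2 l3 q11 q22 q33 q12 q13 q23"
  shows "is_2jet (\<lambda>(x, y, z). z * F (x, y, z)) 0 0 0 c 0 0 l3 0 l1 l2"
  unfolding is_2jet_def
proof (intro allI)
  fix s u v w :: "real poly"
  let ?Q = "smult q11 (u ^ 2) + smult q22 (v ^ 2) + smult q33 (w ^ 2)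
           + smult q12 (u * v) + smult q13 (u * w) + smult q23 (v * w)"
  obtain r where r: "\<forall>t. F (poly (s * u) t, poly (s * v) t, poly (s * w) t) =
     poly ([:c:] + s * (smult l1 u + smult l2 v + smult l3 w) + s ^ 2 * ?Q + s ^ 3 * r) t"
    using assms unfolding is_2jet_def by blast
  show "\<exists>r. \<forall>t. (case (poly (s * u) t, poly (s * v) t, poly (s * w) t) of (x, y, z) \<Rightarrow> z * F (x, y, z)) =
     poly ([:0:] + s * (smult 0 u + smult 0 v + smult c w)
       + s ^ 2 * (smult 0 (u ^ 2) + smult 0 (v ^ 2) + smult l3 (w ^ 2)
           + smult 0 (u * v) + smult l1 (u * w) + smult l2 (v * w)) + s ^ 3 * r) t"
    by (intro exI[of _ "w * ?Q + s * w * r"] allI)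
       (simp only: prod.case r, simp add: algebra_simps power2_eq_square power3_eq_cube)
qed

definition has_2jet :: "(real \<times> real \<times> real \<Rightarrow> real) \<Rightarrow> bool" where
  "has_2jet F \<longleftrightarrow> (\<exists>c l1 l2 l3 q11 q22 q33 q12 q13 q23.
     is_2jet F c l1 l2 l3 q11 q22 q33 q12 q13 q23)"

lemma has_2jet_const: "has_2jet (\<lambda>_. c)"
  unfolding has_2jet_def using is_2jet_const by blast

lemma has_2jet_add: "has_2jet F \<Longrightarrow> has_2jet G \<Longrightarrow> has_2jet (\<lambda>a. F a + G a)"
  unfolding has_2jet_def by (elim exE) (blast intro: is_2jet_add)

lemma has_2jet_mult_coordinate:
  assumes "has_2jet F"
  shows "has_2jet (\<lambda>(x, y, z). x * F (x, y, z))"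
    and "has_2jet (\<lambda>(x, y, z). y * F (x, y, z))"
    and "has_2jet (\<lambda>(x, y, z). z * F (x, y, z))"
  using assms unfolding has_2jet_def
  by (blast intro: is_2jet_mult_x, blast intro: is_2jet_mult_y, blast intro: is_2jet_mult_z)

text \<open>
  Three inductions, one per variable, following \<open>\<real>[x][y][z]\<close> from the inside: a polynomial is its
  constant coefficient plus the outermost variable times a polynomial of lower degree.
\<close>

lemma has_2jet_eval3: "has_2jet (eval3 g)"
proof -
  have x: "has_2jet (\<lambda>(x, y, z). poly p x)" for p :: "real poly"
  proof (induction p)
    case 0
    show ?case using has_2jet_const[of 0] by (simp add: case_prod_unfold)
  next
    case (pCons a p)
    show ?case
      using has_2jet_add[OF has_2jet_const[of a] has_2jet_mult_coordinate(1)[OF pCons.IH]]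
      by (simp add: case_prod_unfold)
  qed
  have xy: "has_2jet (\<lambda>(x, y, z). poly (poly p [:y:]) x)" for p :: "real poly poly"
  proof (induction p)
    case 0
    show ?case using has_2jet_const[of 0] by (simp add: case_prod_unfold)
  next
    case (pCons a p)
    show ?case
      using has_2jet_add[OF x[of a] has_2jet_mult_coordinate(2)[OF pCons.IH]]
      by (simp add: case_prod_unfold)
  qed
  show ?thesis
  proof (induction g)
    case 0
    show ?case using has_2jet_const[of 0] by (simp add: eval3_def case_prod_unfold)
  next
    case (pCons a g)
    show ?case
      using has_2jet_add[OF xy[of a] has_2jet_mult_coordinate(3)[OF pCons.IH]]
      by (simp add: eval3_def case_prod_unfold)
  qed
qed


section \<open>Vanishing along the curve of real zeros\<close>

lemma dvd_imp_eq_0_of_degree_less: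
  fixes p d :: "'a::idom poly"
  assumes "d dvd p" "degree p < degree d"
  shows "p = 0"
  using assms dvd_imp_degree_le[of d p] by force

text \<open>
  With \<open>d = 1 + t\<^sup>4\<close>, the expansion of \<open>g\<close> along the curve reads
  \<open>c + d L + d\<^sup>2 Q + d\<^sup>3 r = 0\<close> in \<open>\<real>[t]\<close>, where \<open>L\<close> and \<open>Q\<close> are the linear and quadratic parts of
  \<open>g\<close> at \<open>(1, t, t\<^sup>2)\<close>. Successively \<open>d\<close> divides \<open>c\<close>, \<open>L\<close> and \<open>Q\<close>, whose degrees are at most
  \<open>0\<close>, \<open>2\<close> and \<open>4\<close>. So \<open>c = 0\<close>, \<open>L = 0\<close>, and \<open>Q\<close> is a multiple of \<open>d\<close>. As \<open>d\<close> is
  \<open>x\<^sup>2 + z\<^sup>2\<close> at \<open>(1, t, t\<^sup>2)\<close>, and the quadratic forms vanishing at all \<open>(1, t, t\<^sup>2)\<close> are the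
  multiples of \<open>y\<^sup>2 - x z\<close>, this determines the quadratic part of \<open>g\<close>.
\<close>

lemma jet_of_vanishing_on_curve:
  fixes g :: "real poly3"
  assumes van: "\<And>t. eval3 g (1 + t ^ 4, (1 + t ^ 4) * t, (1 + t ^ 4) * t ^ 2) = 0"
  shows "\<exists>\<sigma> \<tau>. \<forall>x y z.
    ((\<lambda>s. eval3 g (s * x, s * y, s * z) / s ^ 2)
       \<longlongrightarrow> \<sigma> * (x ^ 2 + z ^ 2) + \<tau> * (y ^ 2 - x * z)) (at 0)"
proof -
  obtain c l1 l2 l3 q11 q22 q33 q12 q13 q23 where
    jet: "is_2jet (eval3 g) c l1 l2 l3 q11 q22 q33 q12 q13 q23"
    using has_2jet_eval3[of g] unfolding has_2jet_def by (elim exE) (rule that)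
  define d :: "real poly" where "d = [:1, 0, 0, 0, 1:]"
  define L where "L = [:l1, l2, l3:]"
  define Q where "Q = [:q11, q12, q22 + q13, q23, q33:]"
  have d0: "d \<noteq> 0" and deg_d: "degree d = 4" by (simp_all add: d_def)
  have dt: "poly d t = 1 + t ^ 4" for t
    by (simp add: d_def power_numeral_reduce)
  obtain r where r: "\<And>t. eval3 g (poly (d * 1) t, poly (d * [:0, 1:]) t, poly (d * [:0, 0, 1:]) t) =
     poly ([:c:] + d * (smult l1 1 + smult l2 [:0, 1:] + smult l3 [:0, 0, 1:])
       + d ^ 2 * (smult q11 (1 ^ 2) + smult q22 ([:0, 1:] ^ 2) + smult q33 ([:0, 0, 1:] ^ 2)
           + smult q12 (1 * [:0, 1:]) + smult q13 (1 * [:0, 0, 1:]) + smult q23 ([:0, 1:] * [:0, 0, 1:]))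
       + d ^ 3 * r) t"
    using jet unfolding is_2jet_def by blast
  have "poly ([:c:] + d * (smult l1 1 + smult l2 [:0, 1:] + smult l3 [:0, 0, 1:])
       + d ^ 2 * (smult q11 (1 ^ 2) + smult q22 ([:0, 1:] ^ 2) + smult q33 ([:0, 0, 1:] ^ 2)
           + smult q12 (1 * [:0, 1:]) + smult q13 (1 * [:0, 0, 1:]) + smult q23 ([:0, 1:] * [:0, 0, 1:]))
       + d ^ 3 * r) t = 0" for t
    unfolding r[symmetric] using van[of t] by (simp add: dt power2_eq_square mult_ac)
  then have "[:c:] + d * (smult l1 1 + smult l2 [:0, 1:] + smult l3 [:0, 0, 1:])
       + d ^ 2 * (smult q11 (1 ^ 2) + smult q22 ([:0, 1:] ^ 2) + smult q33 ([:0, 0, 1:] ^ 2)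
           + smult q12 (1 * [:0, 1:]) + smult q13 (1 * [:0, 0, 1:]) + smult q23 ([:0, 1:] * [:0, 0, 1:]))
       + d ^ 3 * r = 0"
    by (metis poly_all_0_iff_0)
  moreover have "smult l1 1 + smult l2 [:0, 1:] + smult l3 [:0, 0, 1:] = L"
    by (simp add: L_def one_pCons)
  moreover have "smult q11 (1 ^ 2) + smult q22 ([:0, 1:] ^ 2) + smult q33 ([:0, 0, 1:] ^ 2)
      + smult q12 (1 * [:0, 1:]) + smult q13 (1 * [:0, 0, 1:]) + smult q23 ([:0, 1:] * [:0, 0, 1:]) = Q"
    by (simp add: Q_def one_pCons power2_eq_square)
  ultimately have rel: "[:c:] + d * L + d ^ 2 * Q + d ^ 3 * r = 0" by metis
  have "[:c:] = d * - (L + d * Q + d ^ 2 * r)"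
    using rel unfolding eq_neg_iff_add_eq_0 mult_minus_right
    by (simp add: distrib_left power2_eq_square power3_eq_cube add.assoc mult.assoc)
  then have "d dvd [:c:]" by (rule dvdI)
  then have c: "[:c:] = 0" by (rule dvd_imp_eq_0_of_degree_less) (simp add: deg_d)
  have "d * (L + d * Q + d ^ 2 * r) = 0"
    using rel unfolding c
    by (simp add: distrib_left power2_eq_square power3_eq_cube add.assoc mult.assoc)
  then have rel1: "L + d * Q + d ^ 2 * r = 0" using d0 by simp
  then have "L = d * - (Q + d * r)"
    unfolding eq_neg_iff_add_eq_0 mult_minus_right
    by (simp add: distrib_left power2_eq_square add.assoc mult.assoc)
  then have "d dvd L" by (rule dvdI)
  then have L: "L = 0" by (rule dvd_imp_eq_0_of_degree_less) (simp add: deg_d L_def)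
  have "d * (Q + d * r) = 0"
    using rel1 unfolding L by (simp add: distrib_left power2_eq_square mult.assoc)
  then have "Q + d * r = 0" using d0 by simp
  then have "Q = d * - r" unfolding eq_neg_iff_add_eq_0 mult_minus_right .
  \<comment> \<open>Both have the coefficient q33 at \<open>t\<^sup>4\<close>, so the difference has too small a degree.\<close>
  then have "d dvd Q - smult q33 d" by (simp add: dvd_diff dvd_smult)
  moreover have "degree (Q - smult q33 d) < degree d"
    unfolding deg_d by (simp add: Q_def d_def)
  ultimately have "Q - smult q33 d = 0" by (rule dvd_imp_eq_0_of_degree_less)
  then have q: "q11 = q33" "q12 = 0" "q13 = - q22" "q23 = 0"
    by (simp_all add: Q_def d_def)
  have "((\<lambda>s. eval3 g (s * x, s * y, s * z) / s ^ 2)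
       \<longlongrightarrow> q33 * (x ^ 2 + z ^ 2) + q22 * (y ^ 2 - x * z)) (at 0)" for x y z
  proof -
    obtain r where "\<And>t. eval3 g (poly ([:0, 1:] * [:x:]) t, poly ([:0, 1:] * [:y:]) t, poly ([:0, 1:] * [:z:]) t) =
     poly ([:c:] + [:0, 1:] * (smult l1 [:x:] + smult l2 [:y:] + smult l3 [:z:])
       + [:0, 1:] ^ 2 * (smult q11 ([:x:] ^ 2) + smult q22 ([:y:] ^ 2) + smult q33 ([:z:] ^ 2)
           + smult q12 ([:x:] * [:y:]) + smult q13 ([:x:] * [:z:]) + smult q23 ([:y:] * [:z:]))
       + [:0, 1:] ^ 3 * r) t"
      using jet unfolding is_2jet_def by blast
    then have r: "eval3 g (t * x, t * y, t * z) =
        t ^ 2 * (q33 * (x ^ 2 + z ^ 2) + q22 * (y ^ 2 - x * z)) + t ^ 3 * poly r t" for t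
      using c L by (simp add: L_def q algebra_simps)
    have "((\<lambda>s. (q33 * (x ^ 2 + z ^ 2) + q22 * (y ^ 2 - x * z)) + s * poly r s)
        \<longlongrightarrow> (q33 * (x ^ 2 + z ^ 2) + q22 * (y ^ 2 - x * z)) + 0 * poly r 0) (at 0)"
      by (intro tendsto_intros)
    moreover have "\<forall>\<^sub>F s in at 0. (q33 * (x ^ 2 + z ^ 2) + q22 * (y ^ 2 - x * z)) + s * poly r s
        = eval3 g (s * x, s * y, s * z) / s ^ 2"
      by (rule eventually_at_filter[THEN iffD2], rule always_eventually)
         (auto simp: r field_simps power2_eq_square power3_eq_cube)
    ultimately show ?thesis
      by (simp add: filterlim_cong[OF refl refl])
  qed
  then show ?thesis by blast
qed


section \<open>The bad point\<close>

text \<open>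
  The multiplier \<open>h\<close> plays the role of a common denominator. Comparing the terms of degree \<open>4\<close> at
  the origin shows that it cannot be a unit in the local ring there.
\<close>

lemma bad_poly_multiplier_vanishes_at_origin:
  assumes eq: "h ^ 2 * bad_poly = (\<Sum>g\<leftarrow>gs. g ^ 2)"
  shows "eval3 h (0, 0, 0) = 0"
proof -
  define n where "n = length gs"
  have ev: "eval3 h a ^ 2 * eval3 bad_poly a = (\<Sum>i<n. eval3 (gs ! i) a ^ 2)" for a
  proof -
    have "eval3 (h ^ 2 * bad_poly) a = (\<Sum>g\<leftarrow>gs. eval3 g a ^ 2)"
      unfolding eq eval3_sum_list_squares ..
    then show ?thesis
      by (simp add: eval3_mult eval3_power sum_list_sum_nth n_def atLeast0LessThan)
  qed
  define jet_at where "jet_at i \<sigma> \<tau> \<longleftrightarrow> (\<forall>x y z.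
    ((\<lambda>s. eval3 (gs ! i) (s * x, s * y, s * z) / s ^ 2)
       \<longlongrightarrow> \<sigma> * (x ^ 2 + z ^ 2) + \<tau> * (y ^ 2 - x * z)) (at 0))" for i \<sigma> \<tau>
  have "\<exists>\<sigma> \<tau>. jet_at i \<sigma> \<tau>" if i: "i < n" for i
    unfolding jet_at_def
  proof (rule jet_of_vanishing_on_curve)
    fix t :: real
    let ?a = "(1 + t ^ 4, (1 + t ^ 4) * t, (1 + t ^ 4) * t ^ 2)"
    have "eval3 bad_poly ?a = 0"
    proof -
      have 1: "(1 + t ^ 4) ^ 2 - (1 + t ^ 4) ^ 3 + ((1 + t ^ 4) * t ^ 2) ^ 2 = 0"
        by (simp add: algebra_simps power2_eq_square power3_eq_cube power4_eq_xxxx)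
      have 2: "((1 + t ^ 4) * t) ^ 2 - (1 + t ^ 4) * ((1 + t ^ 4) * t ^ 2) = 0"
        by (simp add: algebra_simps power2_eq_square)
      show ?thesis unfolding eval3_bad_poly 1 2 by simp
    qed
    then have "(\<Sum>i<n. eval3 (gs ! i) ?a ^ 2) = 0" using ev[of ?a] by simp
    then have "eval3 (gs ! i) ?a ^ 2 = 0"
      using i by (subst (asm) sum_nonneg_eq_0_iff) auto
    then show "eval3 (gs ! i) ?a = 0" by simp
  qed
  then obtain \<sigma> \<tau> where "\<And>i. i < n \<Longrightarrow> jet_at i (\<sigma> i) (\<tau> i)" by metis
  then have jet: "((\<lambda>s. eval3 (gs ! i) (s * x, s * y, s * z) / s ^ 2)
       \<longlongrightarrow> \<sigma> i * (x ^ 2 + z ^ 2) + \<tau> i * (y ^ 2 - x * z)) (at 0)" if "i < n" for i x y z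
    using that unfolding jet_at_def by blast
  define h0 where "h0 = eval3 h (0, 0, 0)"
  \<comment> \<open>The degree 4 parts of both sides, obtained by dividing by \<open>s\<^sup>4\<close> on a ray and letting \<open>s\<close>
    tend to 0.\<close>
  have leading: "h0 ^ 2 * ((x ^ 2 + z ^ 2) * (x ^ 2 + z ^ 2 + (y ^ 2 - x * z)))
      = (\<Sum>i<n. (\<sigma> i * (x ^ 2 + z ^ 2) + \<tau> i * (y ^ 2 - x * z)) ^ 2)" for x y z
  proof (rule tendsto_unique)
    let ?v = "\<lambda>s::real. (s * x, s * y, s * z)"
    have h: "((\<lambda>s. eval3 h (?v s)) \<longlongrightarrow> h0) (at 0)"
    proof -
      obtain c l1 l2 l3 q11 q22 q33 q12 q13 q23 where
        "is_2jet (eval3 h) c l1 l2 l3 q11 q22 q33 q12 q13 q23"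
        using has_2jet_eval3[of h] unfolding has_2jet_def by (elim exE) (rule that)
      then obtain p where p: "\<And>t. eval3 h (poly ([:0, 1:] * [:x:]) t, poly ([:0, 1:] * [:y:]) t,
          poly ([:0, 1:] * [:z:]) t) = poly p t"
        unfolding is_2jet_def by blast
      have v: "eval3 h (?v t) = poly p t" for t using p[of t] by simp
      have "(poly p \<longlongrightarrow> poly p 0) (at 0)" by (intro tendsto_intros)
      moreover have "h0 = poly p 0" using v[of 0] by (simp add: h0_def)
      ultimately show ?thesis by (simp add: v)
    qed
    \<comment> \<open>\<open>?f s\<close> is \<open>1 / s\<^sup>4\<close> times the value of the polynomial at \<open>s \<cdot> (x, y, z)\<close>.\<close>
    let ?f = "\<lambda>s. (x ^ 2 - s * x ^ 3 + z ^ 2) * (x ^ 2 - s * x ^ 3 + z ^ 2 + (y ^ 2 - x * z))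
        + (s * x * (y ^ 2 - x * z)) ^ 2"
    have "(?f \<longlongrightarrow> (x ^ 2 - 0 * x ^ 3 + z ^ 2) * (x ^ 2 - 0 * x ^ 3 + z ^ 2 + (y ^ 2 - x * z))
        + (0 * x * (y ^ 2 - x * z)) ^ 2) (at 0)"
      by (intro tendsto_intros)
    then have f: "(?f \<longlongrightarrow> (x ^ 2 + z ^ 2) * (x ^ 2 + z ^ 2 + (y ^ 2 - x * z))) (at 0)" by simp
    show "((\<lambda>s. eval3 h (?v s) ^ 2 * ?f s)
        \<longlongrightarrow> h0 ^ 2 * ((x ^ 2 + z ^ 2) * (x ^ 2 + z ^ 2 + (y ^ 2 - x * z)))) (at 0)"
      by (intro tendsto_mult tendsto_power h f)
    have S: "((\<lambda>s. \<Sum>i<n. (eval3 (gs ! i) (?v s) / s ^ 2) ^ 2)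
        \<longlongrightarrow> (\<Sum>i<n. (\<sigma> i * (x ^ 2 + z ^ 2) + \<tau> i * (y ^ 2 - x * z)) ^ 2)) (at 0)"
      by (intro tendsto_sum tendsto_power jet) auto
    have "(\<Sum>i<n. (eval3 (gs ! i) (?v s) / s ^ 2) ^ 2) = eval3 h (?v s) ^ 2 * ?f s" if "s \<noteq> 0" for s
    proof -
      have f': "eval3 bad_poly (?v s) = s ^ 4 * ?f s"
        unfolding eval3_bad_poly by algebra
      have "(\<Sum>i<n. eval3 (gs ! i) (?v s) ^ 2) = s ^ 4 * (eval3 h (?v s) ^ 2 * ?f s)"
        unfolding ev[symmetric] f' by (rule mult.left_commute)
      then show ?thesis
        using that by (simp add: power_divide sum_divide_distrib[symmetric] flip: power_mult)
    qed
    then have "\<forall>\<^sub>F s in at 0. (\<Sum>i<n. (eval3 (gs ! i) (?v s) / s ^ 2) ^ 2) = eval3 h (?v s) ^ 2 * ?f s"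
      by (simp add: eventually_at_filter)
    from S[THEN Lim_transform_eventually, OF this]
    show "((\<lambda>s. eval3 h (?v s) ^ 2 * ?f s)
        \<longlongrightarrow> (\<Sum>i<n. (\<sigma> i * (x ^ 2 + z ^ 2) + \<tau> i * (y ^ 2 - x * z)) ^ 2)) (at 0)" .
  qed simp
  \<comment> \<open>At (0, 1, 0), (1, 0, 0), (1, 1, 0) the pair \<open>(x\<^sup>2 + z\<^sup>2, y\<^sup>2 - x z)\<close> takes the values (0, 1),
    (1, 0), (1, 1), which isolates the three coefficients of the quadratic form in this pair.\<close>
  have "(\<Sum>i<n. \<tau> i ^ 2) = 0" using leading[where x=0 and y=1 and z=0] by simp
  then have \<tau>: "\<tau> i = 0" if "i < n" for i
    using that by (subst (asm) sum_nonneg_eq_0_iff) auto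
  have "h0 ^ 2 = (\<Sum>i<n. \<sigma> i ^ 2)" using leading[where x=1 and y=0 and z=0] by simp
  moreover have "h0 ^ 2 * 2 = (\<Sum>i<n. (\<sigma> i + \<tau> i) ^ 2)" using leading[where x=1 and y=1 and z=0] by simp
  then have "h0 ^ 2 * 2 = (\<Sum>i<n. \<sigma> i ^ 2)" using \<tau> by simp
  ultimately show ?thesis by (simp add: h0_def)
qed

lemma common_denominator:
  assumes "\<forall>r\<in>set rs. eval3 (reduced_denom r) a \<noteq> 0"
  shows "\<exists>h gs. eval3 h a \<noteq> 0 \<and>
    to_fract (h ^ 2) * (\<Sum>r\<leftarrow>rs. r ^ 2) = to_fract (\<Sum>g\<leftarrow>gs. g ^ 2)"
  using assms
proof (induction rs)
  case Nil
  show ?case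
    by (intro exI[of _ 1] exI[of _ "[]"]) (simp add: eval3_def split: prod.split)
next
  case (Cons r rs)
  then obtain h gs where h: "eval3 h a \<noteq> 0"
    and gs: "to_fract (h ^ 2) * (\<Sum>r\<leftarrow>rs. r ^ 2) = to_fract (\<Sum>g\<leftarrow>gs. g ^ 2)" by auto
  define d where "d = reduced_denom r"
  define e where "e = fst (quot_of_fract r)"
  have d: "eval3 d a \<noteq> 0" using Cons.prems by (simp add: d_def)
  have "d \<noteq> 0" by (simp add: d_def reduced_denom_nonzero)
  moreover have "r = Fract e d" by (simp add: d_def e_def Fract_reduced_denom)
  ultimately have e: "to_fract d * r = to_fract e"
    by (simp add: Fract_conv_to_fract)
  have "to_fract ((h * d) ^ 2) * (\<Sum>r\<leftarrow>r # rs. r ^ 2)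
      = to_fract (h ^ 2) * (to_fract d * r) ^ 2
        + to_fract (d ^ 2) * (to_fract (h ^ 2) * (\<Sum>r\<leftarrow>rs. r ^ 2))"
    by (simp add: algebra_simps power2_eq_square)
  also have "\<dots> = to_fract ((h * e) ^ 2 + d ^ 2 * (\<Sum>g\<leftarrow>gs. g ^ 2))"
    unfolding gs e by (simp add: power2_eq_square algebra_simps)
  also have "d ^ 2 * (\<Sum>g\<leftarrow>gs. g ^ 2) = (\<Sum>g\<leftarrow>map ((*) d) gs. g ^ 2)"
    by (simp add: sum_list_const_mult[symmetric] power_mult_distrib o_def)
  also have "(h * e) ^ 2 + \<dots> = (\<Sum>g\<leftarrow>(h * e) # map ((*) d) gs. g ^ 2)" by simp
  finally show ?case using h d by (metis eval3_mult mult_eq_0_iff)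
qed

lemma bad_point_bad_poly: "bad_point bad_poly (0, 0, 0)"
  unfolding bad_point_def
proof (intro allI impI, rule ccontr)
  fix rs :: "ratfun3 list"
  assume f: "to_fract bad_poly = (\<Sum>r\<leftarrow>rs. r ^ 2)"
    and "\<not> (\<exists>r\<in>set rs. eval3 (complexify (reduced_denom r)) (0, 0, 0) = 0)"
  then have "\<forall>r\<in>set rs. eval3 (reduced_denom r) (0, 0, 0) \<noteq> 0"
    by (simp add: eval3_complexify_origin)
  then obtain h gs where h: "eval3 h (0, 0, 0) \<noteq> 0"
    and "to_fract (h ^ 2) * to_fract bad_poly = to_fract (\<Sum>g\<leftarrow>gs. g ^ 2)"
    using common_denominator unfolding f by blast
  then have "h ^ 2 * bad_poly = (\<Sum>g\<leftarrow>gs. g ^ 2)"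
    by (simp flip: to_fract_mult)
  then show False using bad_poly_multiplier_vanishes_at_origin h by blast
qed

theorem theorem0p3:
  shows "\<exists>f :: real poly3.
           psd f \<and> bad_point f (0, 0, 0) \<and> sum_of_squares (fps3_of_poly3 f)"
  using psd_bad_poly bad_point_bad_poly sum_of_squares_fps3_bad_poly by blast

end
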